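(* Let $H$ be a complex Hilbert space and let $A,B$ be bounded positive invertible operators on $H$. Then $A\gg B$ (that is, $\log A\ge\log B$) if and only if $\Delta_x(A)\ge\Delta_x(B)$ for all unit vectors $x\in H$.
   Context: For a bounded positive invertible operator $A$ and a unit vector $x\in H$, the Fujii--Seo (normalized) determinant is $\Delta_x(A):=\exp(\langle(\log A)x,x\rangle)$, with $\log A$ defined by the continuous functional calculus. The chaotic order on bounded positive invertible operators is defined by $A\gg B\iff\log A\ge\log B$, where $S\ge T$ for self-adjoint $S,T$ means $\langle(S-T)x,x\rangle\ge0$ for all $x\in H$. *)

theory Defs
  imports
    "HOL-Analysis.Analysis"
    "HOL-Computational_Algebra.Polynomial"
    "HOL-Library.Complex_Order"
begin

section \<open>Complex Hilbert spaces\<close>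

text \<open>The inner product is linear in its first argument. The order on complex numbers is the one of
  Complex_Order: \<open>z \<le> w\<close> means that \<open>w - z\<close> is real and nonnegative.\<close>

class complex_inner = real_normed_vector +
  fixes scaleC :: "complex \<Rightarrow> 'a \<Rightarrow> 'a" (infixr \<open>*\<^sub>C\<close> 75)
    and cinner :: "'a \<Rightarrow> 'a \<Rightarrow> complex"
  assumes scaleR_scaleC: "r *\<^sub>R x = complex_of_real r *\<^sub>C x"
    and scaleC_add_right: "a *\<^sub>C (x + y) = a *\<^sub>C x + a *\<^sub>C y"
    and scaleC_add_left: "(a + b) *\<^sub>C x = a *\<^sub>C x + b *\<^sub>C x"
    and scaleC_scaleC: "a *\<^sub>C b *\<^sub>C x = (a * b) *\<^sub>C x"
    and cinner_commute: "cinner x y = cnj (cinner y x)"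
    and cinner_add_left: "cinner (x + y) z = cinner x z + cinner y z"
    and cinner_scaleC_left: "cinner (a *\<^sub>C x) y = a * cinner x y"
    and cinner_ge_zero: "0 \<le> cinner x x"
    and cinner_eq_zero_iff: "cinner x x = 0 \<longleftrightarrow> x = 0"
    and norm_eq_sqrt_cinner: "norm x = sqrt (Re (cinner x x))"

class chilbert_space = complex_inner + complete_space

section \<open>Bounded operators\<close>

definition bounded_clinear :: "('a::complex_inner \<Rightarrow> 'a) \<Rightarrow> bool" where
  "bounded_clinear T \<longleftrightarrow> bounded_linear T \<and> (\<forall>c x. T (c *\<^sub>C x) = c *\<^sub>C T x)"

definition positive_op :: "('a::complex_inner \<Rightarrow> 'a) \<Rightarrow> bool" where
  "positive_op T \<longleftrightarrow> (\<forall>x. 0 \<le> cinner (T x) x)"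

definition invertible_op :: "('a::complex_inner \<Rightarrow> 'a) \<Rightarrow> bool" where
  "invertible_op T \<longleftrightarrow> (\<exists>S. bounded_clinear S \<and> S \<circ> T = id \<and> T \<circ> S = id)"

definition op_ge :: "('a::complex_inner \<Rightarrow> 'a) \<Rightarrow> ('a \<Rightarrow> 'a) \<Rightarrow> bool" where
  "op_ge S T \<longleftrightarrow> (\<forall>x. 0 \<le> cinner (S x - T x) x)"

definition op_spectrum :: "('a::complex_inner \<Rightarrow> 'a) \<Rightarrow> complex set" where
  "op_spectrum T = {z. \<not> invertible_op (\<lambda>x. T x - z *\<^sub>C x)}"

section \<open>Continuous functional calculus\<close>

definition op_poly :: "complex poly \<Rightarrow> ('a::complex_inner \<Rightarrow> 'a) \<Rightarrow> 'a \<Rightarrow> 'a" where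
  "op_poly p T x = (\<Sum>i\<le>degree p. coeff p i *\<^sub>C (T ^^ i) x)"

text \<open>For self-adjoint \<open>T\<close> and \<open>f\<close> continuous on the spectrum of \<open>T\<close>, the operator \<open>f(T)\<close> is the
  limit in operator norm of \<open>p\<^sub>n(T)\<close>, where \<open>p\<^sub>n\<close> are polynomials that converge to \<open>f\<close> uniformly
  on the spectrum. They exist because the spectrum is a compact set of reals, and the limit does
  not depend on their choice because the norm of \<open>p(T)\<close> is the supremum of \<open>\<bar>p\<bar>\<close> on the spectrum.\<close>

definition cfc :: "('a::complex_inner \<Rightarrow> 'a) \<Rightarrow> (complex \<Rightarrow> complex) \<Rightarrow> 'a \<Rightarrow> 'a" where
  "cfc T f = (THE S. bounded_clinear S \<and>
     (\<exists>p. uniform_limit (op_spectrum T) (\<lambda>n. poly (p n)) f sequentially \<and>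
          (\<lambda>n. onorm (\<lambda>x. op_poly (p n) T x - S x)) \<longlonglongrightarrow> 0))"

text \<open>The spectrum of a positive invertible operator lies in the positive reals, where the
  principal branch of the complex logarithm is the real logarithm.\<close>

definition op_log :: "('a::complex_inner \<Rightarrow> 'a) \<Rightarrow> 'a \<Rightarrow> 'a" where
  "op_log A = cfc A ln"

definition chaotic_ge :: "('a::complex_inner \<Rightarrow> 'a) \<Rightarrow> ('a \<Rightarrow> 'a) \<Rightarrow> bool" (infix \<open>\<ggreater>\<close> 50) where
  "A \<ggreater> B \<longleftrightarrow> op_ge (op_log A) (op_log B)"

text \<open>The Fujii--Seo determinant is kept complex valued. That it is real for positive invertible
  \<open>A\<close> is a consequence of the self-adjointness of \<open>op_log A\<close>.\<close>

definition fs_det :: "'a::complex_inner \<Rightarrow> ('a \<Rightarrow> 'a) \<Rightarrow> complex" (\<open>\<Delta>\<close>) where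
  "\<Delta> x A = exp (cinner (op_log A x) x)"

end

theory Submission
  imports Defs "HOL-Computational_Algebra.Fundamental_Theorem_Algebra"
begin

text \<open>Write \<open>a(x)\<close> and \<open>b(x)\<close> for the quadratic forms of \<open>log A\<close> and \<open>log B\<close> at \<open>x\<close>. If both are
  real, then \<open>\<Delta> x A\<close> and \<open>\<Delta> x B\<close> are the real exponentials of \<open>a(x)\<close> and \<open>b(x)\<close>, so comparing the
  determinants is comparing the forms on unit vectors, and this is the same as comparing them
  everywhere because \<open>a(r x) = r\<^sup>2 a(x)\<close>. Hence the whole content lies in the fact that the logarithm of a
  positive invertible operator is a bounded operator with real quadratic form
  (\<open>op_log_positive_invertible\<close>). Since the functional calculus is given by a definite description, this
  requires its existence and uniqueness.

  Three facts carry the calculus of a symmetric operator \<open>T\<close>.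

  \<^item> \<^emph>\<open>Location of the spectrum.\<close> If \<open>T - c\<close> has norm at most \<open>k\<close>, the spectrum lies in the disc of
    radius \<open>k\<close> about \<open>c\<close>, by Banach's fixed point theorem. With centres far out on the imaginary axis
    such discs shut out every non-real point. If \<open>T\<close> is positive and invertible, a disc about a point
    \<open>K\<close> with \<open>\<parallel>T\<parallel> \<le> K\<close> has radius less than \<open>K\<close> and confines the spectrum to a compact interval of
    positive reals.

  \<^item> \<^emph>\<open>Norm of a polynomial.\<close> Let \<open>P = p(T)\<close>. A vector on which \<open>P\<close> almost attains its norm is an
    approximate eigenvector of \<open>P\<^sup>* P\<close> for \<open>\<parallel>P\<parallel>\<^sup>2\<close>, so \<open>P\<^sup>* P - \<parallel>P\<parallel>\<^sup>2\<close> is not invertible. It is a polynomial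
    in \<open>T\<close>; factoring this polynomial into linear factors produces a point \<open>z\<close> of the spectrum with
    \<open>\<bar>p(z)\<bar> = \<parallel>P\<parallel>\<close>. Thus \<open>\<parallel>p(T)\<parallel>\<close> is at most the supremum of \<open>\<bar>p\<bar>\<close> on the spectrum (\<open>norm_op_poly_le\<close>).

  \<^item> \<^emph>\<open>Approximation.\<close> By this bound and completeness, a sequence \<open>p\<^sub>n\<close> that converges uniformly on the
    spectrum yields a norm limit of \<open>p\<^sub>n(T)\<close>, which depends only on the limit function. A real
    continuous function on an interval containing the spectrum is a limit of polynomials with real
    coefficients (Weierstrass). For these \<open>p\<^sub>n(T)\<close> is symmetric, so the limit has a real quadratic
    form.\<close>

section \<open>Complex inner products\<close>

instance chilbert_space \<subseteq> banach ..

lemma scaleC_one [simp]: "1 *\<^sub>C x = (x::'a::complex_inner)"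
  using scaleR_scaleC[of 1 x] by simp

lemma scaleC_zero_left [simp]: "0 *\<^sub>C x = (0::'a::complex_inner)"
  using scaleR_scaleC[of 0 x] by simp

lemma scaleC_zero_right [simp]: "a *\<^sub>C (0::'a::complex_inner) = 0"
  using scaleC_add_right[of a "0::'a" 0] by simp

lemma scaleC_minus_left: "(- a) *\<^sub>C x = - (a *\<^sub>C (x::'a::complex_inner))"
  using scaleC_add_left[of a "-a" x] by (simp add: eq_neg_iff_add_eq_0 add.commute)

lemma scaleC_minus_right: "a *\<^sub>C (- x) = - (a *\<^sub>C (x::'a::complex_inner))"
  using scaleC_add_right[of a x "-x"] by (simp add: eq_neg_iff_add_eq_0 add.commute)

lemma scaleC_diff_left: "(a - b) *\<^sub>C x = a *\<^sub>C x - b *\<^sub>C (x::'a::complex_inner)"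
  using scaleC_add_left[of a "-b" x] by (simp add: scaleC_minus_left)

lemma scaleC_diff_right: "a *\<^sub>C (x - y) = a *\<^sub>C x - a *\<^sub>C (y::'a::complex_inner)"
  using scaleC_add_right[of a x "-y"] by (simp add: scaleC_minus_right)

lemma scaleC_sum_right: "a *\<^sub>C sum f I = (\<Sum>i\<in>I. a *\<^sub>C (f i :: 'a::complex_inner))"
  by (induction I rule: infinite_finite_induct) (simp_all add: scaleC_add_right)

lemma cinner_add_right: "cinner x (y + z) = cinner x y + cinner x (z::'a::complex_inner)"
  by (metis cinner_add_left cinner_commute complex_cnj_add)

lemma cinner_scaleC_right: "cinner x (a *\<^sub>C y) = cnj a * cinner x (y::'a::complex_inner)"
  by (metis cinner_scaleC_left cinner_commute complex_cnj_mult)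

lemma cinner_zero_left [simp]: "cinner 0 (y::'a::complex_inner) = 0"
  using cinner_add_left[of 0 0 y] by simp

lemma cinner_zero_right [simp]: "cinner (y::'a::complex_inner) 0 = 0"
  using cinner_add_right[of y 0 0] by simp

lemma cinner_minus_left: "cinner (- x) y = - cinner x (y::'a::complex_inner)"
  using cinner_add_left[of x "-x" y] by (simp add: eq_neg_iff_add_eq_0 add.commute)

lemma cinner_minus_right: "cinner x (- y) = - cinner x (y::'a::complex_inner)"
  using cinner_add_right[of x y "-y"] by (simp add: eq_neg_iff_add_eq_0 add.commute)

lemma cinner_diff_left: "cinner (x - y) z = cinner x z - cinner y (z::'a::complex_inner)"
  using cinner_add_left[of x "-y" z] by (simp add: cinner_minus_left)

lemma cinner_diff_right: "cinner x (y - z) = cinner x y - cinner x (z::'a::complex_inner)"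
  using cinner_add_right[of x y "-z"] by (simp add: cinner_minus_right)

lemma cinner_self: "cinner x x = complex_of_real ((norm (x::'a::complex_inner))\<^sup>2)"
proof -
  have "0 \<le> Re (cinner x x)" "Im (cinner x x) = 0"
    using cinner_ge_zero[of x] by (auto simp: less_eq_complex_def)
  then show ?thesis
    by (simp add: norm_eq_sqrt_cinner complex_eq_iff)
qed

lemma norm_scaleC: "norm (a *\<^sub>C x) = cmod a * norm (x::'a::complex_inner)"
proof -
  have "complex_of_real ((norm (a *\<^sub>C x))\<^sup>2) = (a * cnj a) * complex_of_real ((norm x)\<^sup>2)"
    unfolding cinner_self[symmetric] cinner_scaleC_left cinner_scaleC_right by (simp only: mult_ac)
  also have "\<dots> = complex_of_real ((cmod a * norm x)\<^sup>2)"
    by (simp only: complex_norm_square[symmetric] of_real_mult[symmetric] power_mult_distrib)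
  finally have "(norm (a *\<^sub>C x))\<^sup>2 = (cmod a * norm x)\<^sup>2"
    by (simp only: of_real_eq_iff)
  then show ?thesis
    by (rule power2_eq_imp_eq) simp_all
qed

lemma norm_diff_squared:
  "(norm (x - y :: 'a::complex_inner))\<^sup>2 = (norm x)\<^sup>2 - 2 * Re (cinner x y) + (norm y)\<^sup>2"
proof -
  have "cinner (x - y) (x - y) = cinner x x - cinner x y - cnj (cinner x y) + cinner y y"
    using cinner_commute[of y x] by (simp add: cinner_diff_left cinner_diff_right)
  then have "Re (cinner (x - y) (x - y)) = Re (cinner x x) - 2 * Re (cinner x y) + Re (cinner y y)"
    by simp
  then show ?thesis by (simp add: cinner_self)
qed

lemma cauchy_schwarz: "cmod (cinner x y) \<le> norm x * norm (y::'a::complex_inner)"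
proof (cases "y = 0")
  case False
  define a where "a = cinner x y / complex_of_real ((norm y)\<^sup>2)"
  have "0 \<le> (norm (x - a *\<^sub>C y))\<^sup>2" by simp
  also have "\<dots> = (norm x)\<^sup>2 - 2 * Re (cnj a * cinner x y) + (cmod a)\<^sup>2 * (norm y)\<^sup>2"
    by (simp add: norm_diff_squared cinner_scaleC_right norm_scaleC power_mult_distrib)
  also have "cnj a * cinner x y = complex_of_real ((cmod (cinner x y))\<^sup>2 / (norm y)\<^sup>2)"
    unfolding a_def of_real_divide complex_norm_square by (simp add: mult.commute)
  also have "(cmod a)\<^sup>2 * (norm y)\<^sup>2 = (cmod (cinner x y))\<^sup>2 / (norm y)\<^sup>2"
    using False by (simp add: a_def norm_divide power_divide power2_eq_square norm_mult)
  finally have "(cmod (cinner x y))\<^sup>2 / (norm y)\<^sup>2 \<le> (norm x)\<^sup>2"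
    by simp
  then have "(cmod (cinner x y))\<^sup>2 \<le> (norm x * norm y)\<^sup>2"
    using False by (simp add: divide_simps power_mult_distrib)
  then show ?thesis
    by (rule power2_le_imp_le) simp
qed simp

section \<open>Bounded operators and their inverses\<close>

lemma bounded_clinear_bounded_linear: "bounded_clinear T \<Longrightarrow> bounded_linear T"
  and bounded_clinear_scaleC: "bounded_clinear T \<Longrightarrow> T (c *\<^sub>C x) = c *\<^sub>C T x"
  by (simp_all add: bounded_clinear_def)

lemma bounded_clinearI:
  fixes T :: "'a::complex_inner \<Rightarrow> 'a"
  assumes "\<And>x y. T (x + y) = T x + T y" and "\<And>c x. T (c *\<^sub>C x) = c *\<^sub>C T x"
    and "\<And>x. norm (T x) \<le> norm x * K"
  shows "bounded_clinear T"
  unfolding bounded_clinear_def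
  by (intro conjI allI bounded_linear_intro[where K=K] assms)
    (simp add: scaleR_scaleC assms(2))

lemma bounded_clinear_add: "bounded_clinear T \<Longrightarrow> T (x + y) = T x + T y"
  and bounded_clinear_diff: "bounded_clinear T \<Longrightarrow> T (x - y) = T x - T y"
  by (simp_all add: bounded_clinear_def linear_add linear_diff bounded_linear.linear)

lemma bounded_clinear_zero: "bounded_clinear T \<Longrightarrow> T 0 = 0"
  by (simp add: bounded_clinear_def linear_0 bounded_linear.linear)

lemma bounded_linear_scaleC: "bounded_linear (\<lambda>x::'a::complex_inner. c *\<^sub>C x)"
  by (rule bounded_linear_intro[where K="cmod c"])
    (simp_all add: scaleC_add_right scaleR_scaleC scaleC_scaleC norm_scaleC mult.commute)

lemma bounded_clinear_homothety: "bounded_clinear (\<lambda>x::'a::complex_inner. c *\<^sub>C x)"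
  by (simp add: bounded_clinear_def bounded_linear_scaleC scaleC_scaleC mult.commute)

lemma bounded_clinear_plus:
  "bounded_clinear S \<Longrightarrow> bounded_clinear T \<Longrightarrow> bounded_clinear (\<lambda>x. S x + T x)"
  by (simp add: bounded_clinear_def bounded_linear_add scaleC_add_right)

lemma bounded_clinear_minus:
  "bounded_clinear S \<Longrightarrow> bounded_clinear T \<Longrightarrow> bounded_clinear (\<lambda>x. S x - T x)"
  by (simp add: bounded_clinear_def bounded_linear_sub scaleC_diff_right)

lemma bounded_clinear_compose:
  "bounded_clinear S \<Longrightarrow> bounded_clinear T \<Longrightarrow> bounded_clinear (\<lambda>x. S (T x))"
  by (simp add: bounded_clinear_def bounded_linear_compose)

lemma invertible_opD:
  assumes "invertible_op (T :: 'a::complex_inner \<Rightarrow> 'a)"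
  obtains K where "K > 0" and "\<And>x. norm x \<le> K * norm (T x)"
proof -
  obtain S where S: "bounded_clinear S" and ST: "S \<circ> T = id"
    using assms unfolding invertible_op_def by blast
  obtain K where K: "K > 0" "\<And>x. norm (S x) \<le> norm x * K"
    using bounded_linear.pos_bounded[OF bounded_clinear_bounded_linear[OF S]] by blast
  have "norm x \<le> K * norm (T x)" for x
    using K(2)[of "T x"] fun_cong[OF ST, of x] by (simp add: mult.commute)
  with K(1) that show ?thesis by blast
qed

text \<open>For a bijective linear map, boundedness from below is boundedness of the inverse.\<close>

lemma invertible_opI:
  assumes T: "bounded_clinear (T :: 'a::complex_inner \<Rightarrow> 'a)"
    and below: "\<And>x. norm x \<le> K * norm (T x)" and surj: "\<And>y. \<exists>x. T x = y"
  shows "invertible_op T"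
proof -
  have inj: "x = y" if "T x = T y" for x y
    using below[of "x - y"] that bounded_clinear_diff[OF T, of x y] by simp
  define S where "S y = (SOME x. T x = y)" for y
  have TS: "T (S y) = y" for y
    unfolding S_def using surj[of y] by (rule someI_ex)
  have ST: "S (T x) = x" for x
    using TS inj by blast
  have "bounded_clinear S"
  proof (rule bounded_clinearI)
    show "S (x + y) = S x + S y" for x y
      by (rule inj) (simp add: TS bounded_clinear_add[OF T])
    show "S (c *\<^sub>C x) = c *\<^sub>C S x" for c x
      by (rule inj) (simp add: TS bounded_clinear_scaleC[OF T])
    show "norm (S x) \<le> norm x * K" for x
      using below[of "S x"] by (simp add: TS mult.commute)
  qed
  then show ?thesis
    unfolding invertible_op_def using TS ST by (auto simp: fun_eq_iff)
qed

lemma invertible_op_compose: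
  assumes "invertible_op S" and "invertible_op T"
  shows "invertible_op (\<lambda>x. S (T x))"
proof -
  obtain S' T' where "bounded_clinear S'" "S' \<circ> S = id" "S \<circ> S' = id"
    "bounded_clinear T'" "T' \<circ> T = id" "T \<circ> T' = id"
    using assms unfolding invertible_op_def by blast
  then show ?thesis
    unfolding invertible_op_def
    by (intro exI[of _ "\<lambda>x. T' (S' x)"]) (simp add: bounded_clinear_compose fun_eq_iff)
qed

lemma invertible_op_homothety: "c \<noteq> 0 \<Longrightarrow> invertible_op (\<lambda>x::'a::complex_inner. c *\<^sub>C x)"
  unfolding invertible_op_def
  by (intro exI[of _ "\<lambda>x. inverse c *\<^sub>C x"])
    (simp add: bounded_clinear_homothety fun_eq_iff scaleC_scaleC)

text \<open>Solving \<open>T x - w x = y\<close> means finding a fixed point of \<open>x \<mapsto> (T x - y) / w\<close>, which is a contraction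
  when \<open>\<parallel>T\<parallel> < \<bar>w\<bar>\<close>. Its iterates from \<open>0\<close> are partial sums of the Neumann series.\<close>

lemma invertible_op_small_perturbation:
  fixes T :: "'a::chilbert_space \<Rightarrow> 'a"
  assumes T: "bounded_clinear T" and k: "\<And>x. norm (T x) \<le> k * norm x" and less: "0 \<le> k" "k < cmod w"
  shows "invertible_op (\<lambda>x. T x - w *\<^sub>C x)"
proof (rule invertible_opI[where K="1 / (cmod w - k)"])
  show "bounded_clinear (\<lambda>x. T x - w *\<^sub>C x)"
    by (intro bounded_clinear_minus T bounded_clinear_homothety)
  show "norm x \<le> 1 / (cmod w - k) * norm (T x - w *\<^sub>C x)" for x
  proof -
    have "cmod w * norm x \<le> norm (T x) + norm (T x - w *\<^sub>C x)"
      by (metis norm_scaleC norm_triangle_sub norm_minus_commute add.commute)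
    then have "(cmod w - k) * norm x \<le> norm (T x - w *\<^sub>C x)"
      using k[of x] by (simp add: algebra_simps)
    then show ?thesis using less by (simp add: field_simps)
  qed
  have w: "w \<noteq> 0" using less by auto
  show "\<exists>x. T x - w *\<^sub>C x = y" for y
  proof -
    have "\<exists>!x. inverse w *\<^sub>C (T x - y) = x"
    proof (rule banach_fix_type[where c="k / cmod w"])
      show "0 \<le> k / cmod w" "k / cmod w < 1" using less by (auto simp: divide_simps)
      show "\<forall>x z. dist (inverse w *\<^sub>C (T x - y)) (inverse w *\<^sub>C (T z - y)) \<le> k / cmod w * dist x z"
      proof (intro allI)
        fix x z
        have "inverse w *\<^sub>C (T x - y) - inverse w *\<^sub>C (T z - y) = inverse w *\<^sub>C T (x - z)"
          by (simp add: scaleC_diff_right bounded_clinear_diff[OF T])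
        then show "dist (inverse w *\<^sub>C (T x - y)) (inverse w *\<^sub>C (T z - y)) \<le> k / cmod w * dist x z"
          using k[of "x - z"] w
          by (simp add: dist_norm norm_scaleC norm_inverse divide_inverse mult.commute
              mult_left_mono)
      qed
    qed
    then obtain x where "inverse w *\<^sub>C (T x - y) = x" by blast
    then have "w *\<^sub>C x = T x - y"
      using w by (metis scaleC_scaleC scaleC_one right_inverse)
    then show ?thesis by (intro exI[of _ x]) simp
  qed
qed

section \<open>Polynomials of an operator\<close>

text \<open>Summing beyond the degree allows polynomials of different degrees to be treated together.\<close>

lemma op_poly_eq_sum:
  assumes "degree p \<le> n"
  shows "op_poly p T x = (\<Sum>i\<le>n. coeff p i *\<^sub>C (T ^^ i) x)"
  unfolding op_poly_def using assms
  by (intro sum.mono_neutral_left) (auto simp: coeff_eq_0)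

lemma op_poly_0 [simp]: "op_poly 0 T x = 0"
  by (simp add: op_poly_def)

lemma op_poly_add: "op_poly (p + q) T x = op_poly p T x + op_poly q T x"
proof -
  let ?n = "max (degree p) (degree q)"
  show ?thesis
    using op_poly_eq_sum[of "p + q" ?n T x] op_poly_eq_sum[of p ?n T x] op_poly_eq_sum[of q ?n T x]
    by (simp add: degree_add_le scaleC_add_left sum.distrib)
qed

lemma op_poly_smult: "op_poly (smult c p) T x = c *\<^sub>C op_poly p T x"
  using op_poly_eq_sum[of "smult c p" "degree p" T x]
  by (simp add: op_poly_def degree_smult_le scaleC_sum_right scaleC_scaleC)

lemma op_poly_diff: "op_poly (p - q) T x = op_poly p T x - op_poly q T x"
proof -
  have "op_poly (p + smult (- 1) q) T x = op_poly p T x - op_poly q T x"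
    by (simp only: op_poly_add op_poly_smult scaleC_minus_left scaleC_one) simp
  then show ?thesis by simp
qed

lemma op_poly_pCons:
  assumes "bounded_clinear T"
  shows "op_poly (pCons a p) T x = a *\<^sub>C x + T (op_poly p T x)"
proof -
  have "op_poly (pCons a p) T x = (\<Sum>i\<le>Suc (degree p). coeff (pCons a p) i *\<^sub>C (T ^^ i) x)"
    by (rule op_poly_eq_sum) (simp add: degree_pCons_le)
  also have "\<dots> = a *\<^sub>C x + (\<Sum>i\<le>degree p. T (coeff p i *\<^sub>C (T ^^ i) x))"
    by (simp only: sum.atMost_Suc_shift) (simp add: bounded_clinear_scaleC[OF assms])
  also have "(\<Sum>i\<le>degree p. T (coeff p i *\<^sub>C (T ^^ i) x)) = T (op_poly p T x)"
    unfolding op_poly_def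
    by (simp add: linear_sum[OF bounded_linear.linear[OF bounded_clinear_bounded_linear[OF assms]]])
  finally show ?thesis .
qed

lemma bounded_clinear_op_poly:
  assumes "bounded_clinear T"
  shows "bounded_clinear (op_poly p T)"
proof (induction p)
  case 0
  then show ?case using bounded_clinear_homothety[of 0] by (simp add: op_poly_0[abs_def])
next
  case (pCons a p)
  have "op_poly (pCons a p) T = (\<lambda>x. a *\<^sub>C x + T (op_poly p T x))"
    by (simp add: fun_eq_iff op_poly_pCons[OF assms])
  then show ?case
    using bounded_clinear_plus[OF bounded_clinear_homothety[of a]
        bounded_clinear_compose[OF assms pCons.IH]] by simp
qed

lemma op_poly_mult:
  assumes "bounded_clinear T"
  shows "op_poly (p * q) T x = op_poly p T (op_poly q T x)"
  by (induction p)
    (simp_all add: op_poly_add op_poly_smult op_poly_pCons[OF assms])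

text \<open>Over the complex numbers \<open>p(T)\<close> is a nonzero multiple of a product of operators \<open>T - z\<close>, where \<open>z\<close> runs
  through the roots of \<open>p\<close>. If all of these were invertible, then so would be \<open>p(T)\<close>. This is the half of the
  spectral mapping theorem that says that \<open>0 \<in> \<sigma>(p(T))\<close> implies \<open>0 \<in> p(\<sigma>(T))\<close>.\<close>

lemma op_poly_not_invertible_imp_root:
  fixes T :: "'a::complex_inner \<Rightarrow> 'a"
  assumes T: "bounded_clinear T"
  shows "p \<noteq> 0 \<Longrightarrow> \<not> invertible_op (op_poly p T) \<Longrightarrow> \<exists>z\<in>op_spectrum T. poly p z = 0"
proof (induction "degree p" arbitrary: p)
  case 0
  then obtain c where p: "p = [:c:]" using degree_eq_zeroE by metis
  have "op_poly p T = (\<lambda>x. c *\<^sub>C x)"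
    by (simp add: p fun_eq_iff op_poly_pCons[OF T] bounded_clinear_zero[OF T])
  then show ?case using 0 p invertible_op_homothety[of c] by auto
next
  case (Suc n)
  have "\<not> constant (poly p)"
    using Suc.hyps(2) by (simp add: constant_degree)
  then obtain z where z: "poly p z = 0" using fundamental_theorem_of_algebra by blast
  then obtain q where q: "p = [:- z, 1:] * q" by (metis poly_eq_0_iff_dvd dvdE)
  have eq: "op_poly p T = (\<lambda>x. T (op_poly q T x) - z *\<^sub>C op_poly q T x)"
    by (simp add: q fun_eq_iff op_poly_mult[OF T] op_poly_pCons[OF T] bounded_clinear_zero[OF T]
        scaleC_minus_left del: mult_pCons_left)
  show ?case
  proof (cases "z \<in> op_spectrum T")
    case True
    then show ?thesis using z by blast
  next
    case False
    then have "\<not> invertible_op (op_poly q T)"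
      using Suc.prems(2) invertible_op_compose[of "\<lambda>x. T x - z *\<^sub>C x" "op_poly q T"]
      by (auto simp: op_spectrum_def eq)
    moreover have "q \<noteq> 0" using Suc.prems q by auto
    moreover have "n = degree q"
      using Suc.hyps(2) \<open>q \<noteq> 0\<close> by (simp add: q degree_mult_eq del: mult_pCons_left)
    ultimately obtain w where "w \<in> op_spectrum T" "poly q w = 0" using Suc.hyps(1) by blast
    then show ?thesis by (intro bexI[of _ w]) (simp_all add: q del: mult_pCons_left)
  qed
qed

section \<open>The spectrum of a positive invertible operator\<close>

lemma op_spectrum_in_cball:
  fixes T :: "'a::chilbert_space \<Rightarrow> 'a"
  assumes T: "bounded_clinear T" and z: "z \<in> op_spectrum T"
    and k: "\<And>x. norm (T x - c *\<^sub>C x) \<le> k * norm x" "0 \<le> k"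
  shows "cmod (z - c) \<le> k"
proof (rule ccontr)
  assume "\<not> cmod (z - c) \<le> k"
  then have "invertible_op (\<lambda>x. (T x - c *\<^sub>C x) - (z - c) *\<^sub>C x)"
    by (intro invertible_op_small_perturbation[where k=k] k bounded_clinear_minus
        bounded_clinear_homothety T) simp
  then show False
    using z by (simp add: op_spectrum_def scaleC_diff_left)
qed

text \<open>Self-adjointness of an everywhere defined operator, in a form that does not mention the adjoint.\<close>

definition symmetric_op :: "('a::complex_inner \<Rightarrow> 'a) \<Rightarrow> bool" where
  "symmetric_op T \<longleftrightarrow> (\<forall>x y. cinner (T x) y = cinner x (T y))"

lemma symmetric_opD: "symmetric_op T \<Longrightarrow> cinner (T x) y = cinner x (T y)"
  by (simp add: symmetric_op_def)

lemma symmetric_op_Im: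
  assumes "symmetric_op T"
  shows "Im (cinner (T x) x) = 0"
proof -
  have "cinner (T x) x = cnj (cinner (T x) x)"
    using symmetric_opD[OF assms, of x x] cinner_commute[of x "T x"] by simp
  from arg_cong[OF this, of Im] show ?thesis by simp
qed

lemma positive_op_Re_Im:
  assumes "positive_op T"
  shows "0 \<le> Re (cinner (T x) x)" and "Im (cinner (T x) x) = 0"
  using assms by (simp_all add: positive_op_def less_eq_complex_def)

text \<open>Polarization: that the quadratic form is real at \<open>x + y\<close> and at \<open>x + \<i> y\<close> gives the imaginary and the
  real part of the identity, respectively.\<close>

lemma positive_op_imp_symmetric_op:
  assumes T: "bounded_clinear T" and pos: "positive_op T"
  shows "symmetric_op T"
  unfolding symmetric_op_def
proof (intro allI)
  fix x y
  note im = positive_op_Re_Im(2)[OF pos]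
  have "Im (cinner (T x) y) = - Im (cinner (T y) x)"
    using im[of "x + y"] im[of x] im[of y]
    by (simp add: bounded_clinear_add[OF T] cinner_add_left cinner_add_right)
  moreover have "Re (cinner (T x) y) = Re (cinner (T y) x)"
    using im[of "x + \<i> *\<^sub>C y"] im[of x] im[of y]
    by (simp add: bounded_clinear_add[OF T] bounded_clinear_scaleC[OF T] cinner_add_left
        cinner_add_right cinner_scaleC_left cinner_scaleC_right)
  ultimately show "cinner (T x) y = cinner x (T y)"
    using cinner_commute[of x "T y"] by (simp add: complex_eq_iff)
qed

text \<open>For real \<open>t\<close>, \<open>T + \<i>t\<close> has squared norm at most \<open>K\<^sup>2 + t\<^sup>2\<close>, where \<open>K\<close> bounds \<open>T\<close>, but a point
  \<open>z\<close> with \<open>Im z \<noteq> 0\<close> has squared distance at least \<open>(Im z + t)\<^sup>2\<close> from \<open>-\<i>t\<close>. The latter is larger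
  once \<open>t\<close> is large and of the same sign as \<open>Im z\<close>.\<close>

lemma symmetric_op_spectrum_real:
  fixes T :: "'a::chilbert_space \<Rightarrow> 'a"
  assumes T: "bounded_clinear T" and sym: "symmetric_op T" and z: "z \<in> op_spectrum T"
  shows "Im z = 0"
proof (rule ccontr)
  assume b: "Im z \<noteq> 0"
  obtain K where K: "K > 0" "\<And>x. norm (T x) \<le> norm x * K"
    using bounded_linear.pos_bounded[OF bounded_clinear_bounded_linear[OF T]] by blast
  \<comment> \<open>This choice makes the cross term \<open>2 t Im z\<close> of the square equal to \<open>2 K\<^sup>2\<close>.\<close>
  define t where "t = K\<^sup>2 / Im z"
  define c where "c = Complex 0 (- t)"
  have "cmod (z - c) \<le> sqrt (K\<^sup>2 + t\<^sup>2)"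
  proof (rule op_spectrum_in_cball[OF T z])
    fix x
    have "(norm (T x - c *\<^sub>C x))\<^sup>2 = (norm (T x))\<^sup>2 + t\<^sup>2 * (norm x)\<^sup>2"
      by (simp add: norm_diff_squared norm_scaleC power_mult_distrib cinner_scaleC_right
          symmetric_op_Im[OF sym] c_def cmod_def)
    also have "\<dots> \<le> (norm x * K)\<^sup>2 + t\<^sup>2 * (norm x)\<^sup>2"
      using K(2)[of x] by (intro add_right_mono power_mono) auto
    also have "\<dots> = (sqrt (K\<^sup>2 + t\<^sup>2) * norm x)\<^sup>2"
      by (simp add: power_mult_distrib algebra_simps)
    finally show "norm (T x - c *\<^sub>C x) \<le> sqrt (K\<^sup>2 + t\<^sup>2) * norm x"
      by (rule power2_le_imp_le) simp
  qed simp
  then have "(Re z)\<^sup>2 + (Im z + t)\<^sup>2 \<le> K\<^sup>2 + t\<^sup>2"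
    by (simp add: cmod_def c_def)
  moreover have "(Im z + t)\<^sup>2 = (Im z)\<^sup>2 + 2 * K\<^sup>2 + t\<^sup>2"
    using b by (simp add: t_def power2_sum)
  ultimately have "(Re z)\<^sup>2 + (Im z)\<^sup>2 + K\<^sup>2 \<le> 0" by simp
  then show False using K(1)
    by (metis add_nonneg_pos not_less sum_power2_ge_zero zero_less_power)
qed

text \<open>The quadratic form of \<open>T\<close> is nonnegative at \<open>x - s T x\<close> for every real \<open>s\<close>; the bound comes from
  \<open>s = 1 / K\<close>. It says that \<open>T\<^sup>2 \<le> K T\<close>.\<close>

lemma positive_op_norm_squared_le:
  fixes T :: "'a::complex_inner \<Rightarrow> 'a"
  assumes T: "bounded_clinear T" and pos: "positive_op T"
    and K: "K > 0" "\<And>x. norm (T x) \<le> norm x * K"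
  shows "(norm (T x))\<^sup>2 \<le> K * Re (cinner (T x) x)"
proof -
  define s where "s = complex_of_real (1 / K)"
  let ?y = "T x"
  have sym: "cinner (T ?y) x = cinner ?y ?y"
    using symmetric_opD[OF positive_op_imp_symmetric_op[OF T pos], of ?y x] by simp
  have "0 \<le> Re (cinner (T (x - s *\<^sub>C ?y)) (x - s *\<^sub>C ?y))"
    by (rule positive_op_Re_Im[OF pos])
  also have "\<dots> = Re (cinner ?y x) - 2 / K * (norm ?y)\<^sup>2 + Re (cinner (T ?y) ?y) / K\<^sup>2"
    by (simp add: bounded_clinear_diff[OF T] bounded_clinear_scaleC[OF T] cinner_diff_left
        cinner_diff_right cinner_scaleC_left cinner_scaleC_right s_def sym cinner_self power2_eq_square diff_divide_distrib)
  also have "Re (cinner (T ?y) ?y) / K\<^sup>2 \<le> (norm ?y)\<^sup>2 / K"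
  proof -
    have "Re (cinner (T ?y) ?y) \<le> norm (T ?y) * norm ?y"
      using cauchy_schwarz[of "T ?y" ?y] complex_Re_le_cmod order_trans by blast
    also have "\<dots> \<le> (norm ?y * K) * norm ?y"
      by (intro mult_right_mono K) simp
    finally show ?thesis using K(1) by (simp add: field_simps power2_eq_square)
  qed
  finally show ?thesis using K(1) by (simp add: field_simps)
qed

text \<open>Let \<open>K\<close> bound \<open>T\<close> and \<open>L\<close> bound its inverse. Then
  \<open>\<parallel>(T - K) x\<parallel>\<^sup>2 = \<parallel>T x\<parallel>\<^sup>2 - 2 K \<langle>T x, x\<rangle> + K\<^sup>2 \<parallel>x\<parallel>\<^sup>2\<close> is at most \<open>K\<^sup>2 \<parallel>x\<parallel>\<^sup>2 - \<parallel>T x\<parallel>\<^sup>2\<close>, hence at most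
  \<open>(K\<^sup>2 - 1 / L\<^sup>2) \<parallel>x\<parallel>\<^sup>2\<close>. So the spectrum lies in a disc about \<open>K\<close> that does not reach \<open>0\<close>.\<close>

lemma positive_invertible_op_spectrum:
  fixes T :: "'a::chilbert_space \<Rightarrow> 'a"
  assumes T: "bounded_clinear T" and pos: "positive_op T" and inv: "invertible_op T"
  obtains a b where "0 < a" and "op_spectrum T \<subseteq> complex_of_real ` {a..b}"
proof -
  obtain K where K: "K > 0" "\<And>x. norm (T x) \<le> norm x * K"
    using bounded_linear.pos_bounded[OF bounded_clinear_bounded_linear[OF T]] by blast
  obtain L where L: "L > 0" "\<And>x. norm x \<le> L * norm (T x)"
    using invertible_opD[OF inv] by blast
  \<comment> \<open>The minimum keeps the radicand in the definition of \<open>k\<close> nonnegative on the zero space, where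
    \<open>K L < 1\<close> is possible.\<close>
  define d where "d = min (K\<^sup>2) (1 / L\<^sup>2)"
  have d: "0 < d" "d \<le> K\<^sup>2" "d * L\<^sup>2 \<le> 1"
    using K(1) L(1) by (auto simp: d_def min_def field_simps)
  define k where "k = sqrt (K\<^sup>2 - d)"
  have k: "0 \<le> k" "k < K"
    using d K(1) by (auto simp: k_def intro: real_less_lsqrt)
  have ball: "cmod (z - complex_of_real K) \<le> k" if "z \<in> op_spectrum T" for z
  proof (rule op_spectrum_in_cball[OF T that _ k(1)])
    fix x
    have "(norm (T x - complex_of_real K *\<^sub>C x))\<^sup>2
        = (norm (T x))\<^sup>2 - 2 * K * Re (cinner (T x) x) + K\<^sup>2 * (norm x)\<^sup>2"
      by (simp add: norm_diff_squared norm_scaleC power_mult_distrib cinner_scaleC_right)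
    also have "\<dots> \<le> K\<^sup>2 * (norm x)\<^sup>2 - (norm (T x))\<^sup>2"
      using positive_op_norm_squared_le[OF T pos K, of x] by simp
    also have "\<dots> \<le> K\<^sup>2 * (norm x)\<^sup>2 - d * (norm x)\<^sup>2"
    proof -
      have "d * (norm x)\<^sup>2 \<le> d * (L * norm (T x))\<^sup>2"
        using d(1) L(2)[of x] by (intro mult_left_mono power_mono) auto
      also have "\<dots> = (d * L\<^sup>2) * (norm (T x))\<^sup>2" by (simp add: power_mult_distrib)
      also have "\<dots> \<le> (norm (T x))\<^sup>2" using d(3) by (rule mult_left_le_one_le[rotated 2]) (use d in auto)
      finally show ?thesis by simp
    qed
    also have "\<dots> = (k * norm x)\<^sup>2"
      using d(2) by (simp add: k_def power_mult_distrib algebra_simps)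
    finally show "norm (T x - complex_of_real K *\<^sub>C x) \<le> k * norm x"
      by (rule power2_le_imp_le) (use k(1) in simp)
  qed
  have "op_spectrum T \<subseteq> complex_of_real ` {K - k..K + k}"
  proof
    fix z assume z: "z \<in> op_spectrum T"
    have "Im z = 0"
      by (rule symmetric_op_spectrum_real[OF T positive_op_imp_symmetric_op[OF T pos] z])
    moreover have "\<bar>Re z - K\<bar> \<le> k"
      using ball[OF z] abs_Re_le_cmod[of "z - complex_of_real K"] by simp
    ultimately show "z \<in> complex_of_real ` {K - k..K + k}"
      by (intro image_eqI[of _ _ "Re z"]) (auto simp: complex_eq_iff)
  qed
  with k show ?thesis by (intro that[of "K - k"]) auto
qed

section \<open>The norm of a polynomial of a symmetric operator\<close>

lemma op_poly_commute: "bounded_clinear T \<Longrightarrow> op_poly p T (T x) = T (op_poly p T x)"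
  by (induction p) (simp_all add: op_poly_pCons bounded_clinear_zero bounded_clinear_add
      bounded_clinear_scaleC)

text \<open>The adjoint of \<open>p(T)\<close> is the polynomial in \<open>T\<close> with conjugated coefficients.\<close>

lemma op_poly_adjoint:
  assumes T: "bounded_clinear T" and sym: "symmetric_op T"
  shows "cinner (op_poly p T x) y = cinner x (op_poly (map_poly cnj p) T y)"
  by (induction p arbitrary: y)
    (simp_all add: map_poly_pCons op_poly_pCons[OF T] cinner_add_left cinner_add_right
      cinner_scaleC_left cinner_scaleC_right symmetric_opD[OF sym] op_poly_commute[OF T])

text \<open>A normal operator and its adjoint have the same norm at every vector.\<close>

lemma norm_op_poly_map_cnj:
  assumes T: "bounded_clinear T" and sym: "symmetric_op T"
  shows "norm (op_poly (map_poly cnj p) T x) = norm (op_poly p T x)"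
proof -
  let ?P = "op_poly p T" and ?Q = "op_poly (map_poly cnj p) T"
  have "?P (?Q x) = ?Q (?P x)"
    by (simp flip: op_poly_mult[OF T] add: mult.commute)
  then have "cinner (?Q x) (?Q x) = cinner (?P x) (?P x)"
    by (metis op_poly_adjoint[OF T sym] cinner_commute)
  then show ?thesis by (simp add: norm_eq_sqrt_cinner)
qed

lemma op_poly_const: "op_poly [:c:] T x = c *\<^sub>C x"
  by (simp add: op_poly_def)

text \<open>Let \<open>P = p(T)\<close>, \<open>Q\<close> its adjoint, and \<open>M = \<parallel>P\<parallel>\<^sup>2\<close>. Expanding the square and using \<open>\<parallel>Q P x\<parallel> \<le> M \<parallel>x\<parallel>\<close> gives
  \<open>\<parallel>(Q P - M) x\<parallel>\<^sup>2 \<le> 2 M (M \<parallel>x\<parallel>\<^sup>2 - \<parallel>P x\<parallel>\<^sup>2)\<close>. If \<open>Q P - M\<close> were invertible, hence bounded below, then the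
  right-hand side would be at least a fixed positive multiple of \<open>\<parallel>x\<parallel>\<^sup>2\<close>, so the norm of \<open>P\<close> would be
  strictly less than itself.\<close>

lemma op_poly_onorm_squared_not_invertible:
  fixes T :: "'a::complex_inner \<Rightarrow> 'a"
  assumes T: "bounded_clinear T" and sym: "symmetric_op T" and nontriv: "\<exists>x::'a. x \<noteq> 0"
  shows "\<not> invertible_op
    (op_poly (map_poly cnj p * p - [:complex_of_real ((onorm (op_poly p T))\<^sup>2):]) T)"
proof
  let ?P = "op_poly p T" and ?Q = "op_poly (map_poly cnj p) T"
  let ?N = "onorm ?P" and ?M = "(onorm ?P)\<^sup>2"
  let ?S = "op_poly (map_poly cnj p * p - [:complex_of_real ?M:]) T"
  assume "invertible_op ?S"
  then obtain K where K: "K > 0" "\<And>x. norm x \<le> K * norm (?S x)"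
    using invertible_opD by blast
  have bl: "bounded_linear ?P"
    by (intro bounded_clinear_bounded_linear bounded_clinear_op_poly T)
  have *: "(norm x)\<^sup>2 \<le> 2 * K\<^sup>2 * ?M * (?M * (norm x)\<^sup>2 - (norm (?P x))\<^sup>2)" for x
  proof -
    have S: "?S x = ?Q (?P x) - complex_of_real ?M *\<^sub>C x"
      by (simp add: op_poly_diff op_poly_mult[OF T] op_poly_const)
    have "norm (?Q (?P x)) \<le> ?N * (?N * norm x)"
      using onorm[OF bl, of "?P x"] mult_left_mono[OF onorm[OF bl, of x] onorm_pos_le[OF bl]]
      by (simp add: norm_op_poly_map_cnj[OF T sym])
    then have "(norm (?Q (?P x)))\<^sup>2 \<le> (?M * norm x)\<^sup>2"
      by (intro power_mono) (simp_all add: power2_eq_square)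
    moreover have "Re (cinner (?Q (?P x)) x) = (norm (?P x))\<^sup>2"
      using arg_cong[OF op_poly_adjoint[OF T sym, of p x "?P x"], of Re]
        cinner_commute[of "?Q (?P x)" x]
      by (simp add: cinner_self del: of_real_power)
    ultimately have "(norm (?S x))\<^sup>2 \<le> (?M * norm x)\<^sup>2 - 2 * (?M * (norm (?P x))\<^sup>2) + (?M * norm x)\<^sup>2"
      unfolding S norm_diff_squared by (simp add: cinner_scaleC_right norm_scaleC norm_power)
    also have "\<dots> = 2 * ?M * (?M * (norm x)\<^sup>2 - (norm (?P x))\<^sup>2)"
      by (simp add: algebra_simps power2_eq_square)
    finally have "K\<^sup>2 * (norm (?S x))\<^sup>2 \<le> K\<^sup>2 * (2 * ?M * (?M * (norm x)\<^sup>2 - (norm (?P x))\<^sup>2))"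
      by (rule mult_left_mono) simp
    moreover have "(norm x)\<^sup>2 \<le> (K * norm (?S x))\<^sup>2"
      using K(2)[of x] by (intro power_mono) auto
    ultimately show ?thesis by (simp add: power_mult_distrib mult_ac)
  qed
  have M: "?M > 0"
  proof -
    obtain x :: 'a where "x \<noteq> 0" using nontriv by blast
    then show ?thesis using *[of x] by (cases "?M = 0") auto
  qed
  define b where "b = max 0 (?M - 1 / (2 * K\<^sup>2 * ?M))"
  have b: "0 \<le> b" "b < ?M" "?M - 1 / (2 * K\<^sup>2 * ?M) \<le> b"
    using M K(1) by (auto simp: b_def)
  have "norm (?P x) \<le> sqrt b * norm x" for x
  proof -
    have "(norm (?P x))\<^sup>2 \<le> (?M - 1 / (2 * K\<^sup>2 * ?M)) * (norm x)\<^sup>2"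
    proof -
      define c where "c = 2 * K\<^sup>2 * ?M"
      have "c > 0" using M K(1) by (simp add: c_def)
      with *[of x] show ?thesis
        unfolding c_def[symmetric] by (simp add: field_simps)
    qed
    also have "\<dots> \<le> b * (norm x)\<^sup>2"
      by (intro mult_right_mono b) simp
    also have "\<dots> = (sqrt b * norm x)\<^sup>2"
      using b(1) by (simp add: power_mult_distrib)
    finally show ?thesis
      by (rule power2_le_imp_le) (use b(1) in simp)
  qed
  then have "?N \<le> sqrt b"
    by (intro onorm_bound) (use b(1) in auto)
  then have "?M \<le> (sqrt b)\<^sup>2"
    by (intro power_mono onorm_pos_le[OF bl])
  then show False using b by simp
qed

text \<open>The case \<open>p(z) = z\<close>: since \<open>T\<^sup>2 - \<parallel>T\<parallel>\<^sup>2\<close> is not invertible, \<open>z\<^sup>2 - \<parallel>T\<parallel>\<^sup>2\<close> has a root in the spectrum.\<close>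

lemma op_spectrum_nonempty:
  fixes T :: "'a::complex_inner \<Rightarrow> 'a"
  assumes T: "bounded_clinear T" and sym: "symmetric_op T" and nontriv: "\<exists>x::'a. x \<noteq> 0"
  shows "op_spectrum T \<noteq> {}"
proof -
  let ?r = "map_poly cnj [:0, 1:] * [:0, 1:] - [:complex_of_real ((onorm (op_poly [:0, 1:] T))\<^sup>2):]"
  have "?r \<noteq> 0" by (simp add: map_poly_pCons)
  then show ?thesis
    using op_poly_not_invertible_imp_root[OF T _
        op_poly_onorm_squared_not_invertible[OF T sym nontriv, of "[:0, 1:]"]]
    by blast
qed

text \<open>There is a point \<open>z\<close> of the spectrum with \<open>\<bar>p(z)\<bar> = \<parallel>p(T)\<parallel>\<close>: a root of \<open>p\<^sup>* p - \<parallel>p(T)\<parallel>\<^sup>2\<close>, where \<open>p\<^sup>*\<close> has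
  the conjugated coefficients and takes the value \<open>cnj (p(z))\<close> because \<open>z\<close> is real. On the zero space the
  spectrum is empty, but there is nothing to bound.\<close>

lemma norm_op_poly_le:
  fixes T :: "'a::chilbert_space \<Rightarrow> 'a"
  assumes T: "bounded_clinear T" and sym: "symmetric_op T"
    and s: "\<And>z. z \<in> op_spectrum T \<Longrightarrow> cmod (poly p z) \<le> s"
  shows "norm (op_poly p T x) \<le> s * norm x"
proof (cases "\<exists>x::'a. x \<noteq> 0")
  case True
  let ?N = "onorm (op_poly p T)"
  let ?r = "map_poly cnj p * p - [:complex_of_real (?N\<^sup>2):]"
  have bl: "bounded_linear (op_poly p T)"
    by (intro bounded_clinear_bounded_linear bounded_clinear_op_poly T)
  have "\<exists>z\<in>op_spectrum T. poly ?r z = 0"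
  \<comment> \<open>If \<open>p\<^sup>* p\<close> is constant, every point of the spectrum is a root.\<close>
  proof (cases "?r = 0")
    case True
    then show ?thesis using op_spectrum_nonempty[OF T sym \<open>\<exists>x. x \<noteq> 0\<close>] by auto
  next
    case False
    then show ?thesis
      by (rule op_poly_not_invertible_imp_root[OF T])
        (rule op_poly_onorm_squared_not_invertible[OF T sym True])
  qed
  then obtain z where z: "z \<in> op_spectrum T" and root: "poly ?r z = 0" by blast
  have "cnj z = z"
    using symmetric_op_spectrum_real[OF T sym z] by (simp add: complex_eq_iff)
  then have "poly (map_poly cnj p) z = cnj (poly p z)"
    using poly_cnj[of p z] by simp
  then have "complex_of_real ((cmod (poly p z))\<^sup>2) = complex_of_real (?N\<^sup>2)"
    using root by (simp add: complex_norm_square mult.commute del: of_real_power)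
  then have "cmod (poly p z) = ?N"
    using onorm_pos_le[OF bl] by (simp only: of_real_eq_iff) (simp add: power2_eq_iff_nonneg)
  then have "?N \<le> s" using s[OF z] by simp
  then show ?thesis
    using onorm[OF bl, of x] mult_right_mono[of ?N s "norm x"] by simp
next
  case False
  then show ?thesis by (metis mult_zero_right norm_zero order_refl)
qed

section \<open>The functional calculus of a symmetric operator\<close>

lemma onorm_tendsto_imp_pointwise:
  fixes F :: "nat \<Rightarrow> 'a::complex_inner \<Rightarrow> 'a"
  assumes F: "\<And>n. bounded_clinear (F n)" and S: "bounded_clinear S"
    and lim: "(\<lambda>n. onorm (\<lambda>x. F n x - S x)) \<longlonglongrightarrow> 0"
  shows "(\<lambda>n. F n x) \<longlonglongrightarrow> S x"
proof -
  have "(\<lambda>n. onorm (\<lambda>x. F n x - S x) * norm x) \<longlonglongrightarrow> 0"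
    using tendsto_mult_left_zero[OF lim] .
  then have "(\<lambda>n. F n x - S x) \<longlonglongrightarrow> 0"
    by (rule Lim_null_comparison[rotated])
      (intro always_eventually allI onorm bounded_clinear_bounded_linear bounded_clinear_minus F S)
  then show ?thesis by (rule LIM_zero_cancel)
qed

text \<open>The bound on \<open>\<parallel>p(T)\<parallel>\<close> makes \<open>p\<^sub>n(T)\<close> a Cauchy sequence in the Banach space of bounded real-linear maps;
  complex linearity passes to the limit pointwise.\<close>

lemma op_poly_converges:
  fixes T :: "'a::chilbert_space \<Rightarrow> 'a"
  assumes T: "bounded_clinear T" and sym: "symmetric_op T"
    and lim: "uniform_limit (op_spectrum T) (\<lambda>n. poly (p n)) f sequentially"
  obtains S where "bounded_clinear S" and "(\<lambda>n. onorm (\<lambda>x. op_poly (p n) T x - S x)) \<longlonglongrightarrow> 0"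
proof -
  have bl: "bounded_linear (op_poly q T)" for q
    by (intro bounded_clinear_bounded_linear bounded_clinear_op_poly T)
  define X where "X n = Blinfun (op_poly (p n) T)" for n
  have X: "blinfun_apply (X n) = op_poly (p n) T" for n
    unfolding X_def by (rule bounded_linear_Blinfun_apply[OF bl])
  have "Cauchy X"
  proof (rule CauchyI)
    fix e :: real assume e: "0 < e"
    have "\<forall>\<^sub>F n in sequentially. \<forall>z\<in>op_spectrum T. dist (poly (p n) z) (f z) < e / 3"
      by (rule uniform_limitD[OF lim]) (use e in simp)
    then obtain N where N: "\<And>n z. n \<ge> N \<Longrightarrow> z \<in> op_spectrum T \<Longrightarrow> dist (poly (p n) z) (f z) < e / 3"
      unfolding eventually_sequentially by blast
    show "\<exists>M. \<forall>m\<ge>M. \<forall>n\<ge>M. norm (X m - X n) < e"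
    proof (intro exI allI impI)
      fix m n assume mn: "N \<le> m" "N \<le> n"
      have "norm (X m - X n) \<le> 2 * e / 3"
      proof (rule norm_blinfun_bound)
        fix x
        have "norm (op_poly (p m - p n) T x) \<le> 2 * e / 3 * norm x"
        proof (rule norm_op_poly_le[OF T sym])
          fix z assume z: "z \<in> op_spectrum T"
          have "dist (poly (p m) z) (poly (p n) z) < 2 * e / 3"
            using dist_triangle_less_add[of "poly (p m) z" "f z" "e / 3" "poly (p n) z" "e / 3"]
              N[OF mn(1) z] N[OF mn(2) z] by (simp add: dist_commute)
          then show "cmod (poly (p m - p n) z) \<le> 2 * e / 3"
            by (simp add: dist_norm)
        qed
        then show "norm (blinfun_apply (X m - X n) x) \<le> 2 * e / 3 * norm x"
          by (simp add: blinfun.diff_left X op_poly_diff)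
      qed (use e in simp)
      also have "\<dots> < e" using e by simp
      finally show "norm (X m - X n) < e" .
    qed
  qed
  then obtain L where L: "X \<longlonglongrightarrow> L"
    using Cauchy_convergent_iff convergent_def by blast
  let ?S = "blinfun_apply L"
  have ptw: "(\<lambda>n. op_poly (p n) T x) \<longlonglongrightarrow> ?S x" for x
    using bounded_linear.tendsto[OF blinfun.bounded_linear_left L, of x] by (simp add: X)
  have "?S (c *\<^sub>C x) = c *\<^sub>C ?S x" for c x
    using LIMSEQ_unique[OF ptw[of "c *\<^sub>C x"]]
      bounded_linear.tendsto[OF bounded_linear_scaleC ptw[of x], of c]
    by (simp add: bounded_clinear_scaleC[OF bounded_clinear_op_poly[OF T]])
  then have "bounded_clinear ?S"
    by (simp add: bounded_clinear_def blinfun.bounded_linear_right)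
  moreover have "(\<lambda>n. onorm (\<lambda>x. op_poly (p n) T x - ?S x)) \<longlonglongrightarrow> 0"
  proof -
    have "blinfun_apply (X n - L) = (\<lambda>x. op_poly (p n) T x - ?S x)" for n
      by (simp add: fun_eq_iff blinfun.diff_left X)
    then show ?thesis
      using tendsto_norm_zero[OF LIM_zero[OF L]] by (simp add: norm_blinfun.rep_eq)
  qed
  ultimately show ?thesis by (rule that)
qed

text \<open>\<open>p\<^sub>n - q\<^sub>n\<close> tends to \<open>0\<close> uniformly on the spectrum, so \<open>(p\<^sub>n - q\<^sub>n)(T)\<close> tends to \<open>0\<close>.\<close>

lemma op_poly_limit_unique:
  fixes T :: "'a::chilbert_space \<Rightarrow> 'a"
  assumes T: "bounded_clinear T" and sym: "symmetric_op T"
    and p: "uniform_limit (op_spectrum T) (\<lambda>n. poly (p n)) f sequentially"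
    and q: "uniform_limit (op_spectrum T) (\<lambda>n. poly (q n)) f sequentially"
    and R: "bounded_clinear R" "(\<lambda>n. onorm (\<lambda>x. op_poly (p n) T x - R x)) \<longlonglongrightarrow> 0"
    and S: "bounded_clinear S" "(\<lambda>n. onorm (\<lambda>x. op_poly (q n) T x - S x)) \<longlonglongrightarrow> 0"
  shows "R = S"
proof
  fix x
  note bc = bounded_clinear_op_poly[OF T]
  have "uniform_limit (op_spectrum T) (\<lambda>n z. poly (p n) z - poly (q n) z) (\<lambda>z. f z - f z) sequentially"
    by (intro uniform_limit_intros p q)
  moreover have "poly (p n - q n) = (\<lambda>z. poly (p n) z - poly (q n) z)" for n
    by (simp add: fun_eq_iff)
  ultimately have diff: "uniform_limit (op_spectrum T) (\<lambda>n. poly (p n - q n)) (\<lambda>z. 0) sequentially"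
    by simp
  have "(\<lambda>n. op_poly (p n - q n) T x) \<longlonglongrightarrow> 0"
  proof (rule tendstoI)
    fix e :: real assume e: "0 < e"
    \<comment> \<open>The summand \<open>1\<close> only avoids a division by zero for \<open>x = 0\<close>.\<close>
    define d where "d = e / (norm x + 1)"
    have d: "0 < d" "d * norm x < e"
      using e by (auto simp: d_def divide_simps add_nonneg_pos)
    have "\<forall>\<^sub>F n in sequentially. \<forall>z\<in>op_spectrum T. cmod (poly (p n - q n) z) < d"
      using uniform_limitD[OF diff d(1)] by (simp add: dist_norm)
    then show "\<forall>\<^sub>F n in sequentially. dist (op_poly (p n - q n) T x) 0 < e"
    proof eventually_elim
      case (elim n)
      then have "norm (op_poly (p n - q n) T x) \<le> d * norm x"
        by (intro norm_op_poly_le[OF T sym]) (simp add: less_imp_le)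
      with d(2) show ?case by simp
    qed
  qed
  moreover have "(\<lambda>n. op_poly (p n - q n) T x) \<longlonglongrightarrow> R x - S x"
    unfolding op_poly_diff
    by (intro tendsto_diff onorm_tendsto_imp_pointwise[OF bc R] onorm_tendsto_imp_pointwise[OF bc S])
  ultimately show "R x = S x"
    using LIMSEQ_unique by fastforce
qed

lemma cfc_eqI:
  fixes T :: "'a::chilbert_space \<Rightarrow> 'a"
  assumes "bounded_clinear T" "symmetric_op T"
    and "uniform_limit (op_spectrum T) (\<lambda>n. poly (p n)) f sequentially"
    and "bounded_clinear S" "(\<lambda>n. onorm (\<lambda>x. op_poly (p n) T x - S x)) \<longlonglongrightarrow> 0"
  shows "cfc T f = S"
  unfolding cfc_def
  by (rule the_equality) (use assms op_poly_limit_unique[OF assms(1,2)] in blast)+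

text \<open>Weierstrass approximation. Real coefficients are expressed as invariance under conjugation, the
  form in which they interact with the adjoint of \<open>p(T)\<close>.\<close>

lemma real_poly_approximation:
  fixes g :: "real \<Rightarrow> real"
  assumes "continuous_on {a..b} g" and "0 < e"
  obtains p :: "complex poly"
  where "map_poly cnj p = p"
    and "\<And>x. x \<in> {a..b} \<Longrightarrow> cmod (poly p (complex_of_real x) - complex_of_real (g x)) < e"
proof -
  obtain h where "polynomial_function h" and h: "\<And>x. x \<in> {a..b} \<Longrightarrow> norm (g x - h x) < e"
    using Stone_Weierstrass_polynomial_function[OF compact_Icc assms] by blast
  then obtain c n where hc: "h = (\<lambda>x. \<Sum>i\<le>n. c i * x ^ i)"
    by (auto simp flip: real_polynomial_function_eq simp: real_polynomial_function_iff_sum)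
  define p where "p = (\<Sum>i\<le>n. monom (complex_of_real (c i)) i)"
  have "poly p (complex_of_real x) = complex_of_real (h x)" for x
    by (simp add: p_def hc poly_sum poly_monom)
  then have "cmod (poly p (complex_of_real x) - complex_of_real (g x)) = norm (g x - h x)" for x
    by (metis norm_minus_commute norm_of_real of_real_diff real_norm_def)
  moreover have "map_poly cnj p = p"
    by (rule poly_eqI) (auto simp: p_def coeff_map_poly coeff_sum intro!: sum.cong)
  ultimately show ?thesis using h by (intro that[of p]) simp_all
qed

lemma cfc_real_valued:
  fixes T :: "'a::chilbert_space \<Rightarrow> 'a"
  assumes T: "bounded_clinear T" and sym: "symmetric_op T"
    and spec: "op_spectrum T \<subseteq> complex_of_real ` {a..b}"
    and cont: "continuous_on {a..b} g"
    and f: "\<And>x. x \<in> {a..b} \<Longrightarrow> f (complex_of_real x) = complex_of_real (g x)"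
  shows "bounded_clinear (cfc T f)" and "Im (cinner (cfc T f x) x) = 0"
proof -
  have "\<exists>p. map_poly cnj p = p \<and> (\<forall>x\<in>{a..b}.
      cmod (poly p (complex_of_real x) - complex_of_real (g x)) < inverse (real (Suc n)))" for n
    by (rule real_poly_approximation[OF cont, of "inverse (real (Suc n))"]) auto
  then obtain p where real: "\<And>n. map_poly cnj (p n) = p n" and approx: "\<And>n x. x \<in> {a..b} \<Longrightarrow>
      cmod (poly (p n) (complex_of_real x) - complex_of_real (g x)) < inverse (real (Suc n))"
    by metis
  have lim: "uniform_limit (op_spectrum T) (\<lambda>n. poly (p n)) f sequentially"
  proof (rule uniform_limitI)
    fix e :: real assume "0 < e"
    then have "\<forall>\<^sub>F n in sequentially. inverse (real (Suc n)) < e"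
      using order_tendstoD(2)[OF LIMSEQ_inverse_real_of_nat] by blast
    then show "\<forall>\<^sub>F n in sequentially. \<forall>z\<in>op_spectrum T. dist (poly (p n) z) (f z) < e"
    proof eventually_elim
      case (elim n)
      show ?case
      proof
        fix z assume "z \<in> op_spectrum T"
        then obtain t where "t \<in> {a..b}" "z = complex_of_real t" using spec by blast
        then show "dist (poly (p n) z) (f z) < e"
          using approx[of t n] elim by (simp add: f dist_norm)
      qed
    qed
  qed
  obtain S where S: "bounded_clinear S" "(\<lambda>n. onorm (\<lambda>x. op_poly (p n) T x - S x)) \<longlonglongrightarrow> 0"
    using op_poly_converges[OF T sym lim] by blast
  have cfc: "cfc T f = S"
    by (rule cfc_eqI[OF T sym lim S])
  then show "bounded_clinear (cfc T f)" using S(1) by simp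
  have "(\<lambda>n. op_poly (p n) T x) \<longlonglongrightarrow> S x"
    by (rule onorm_tendsto_imp_pointwise[OF bounded_clinear_op_poly[OF T] S])
  moreover have "bounded_linear (\<lambda>y. Im (cinner y x))"
    by (rule bounded_linear_intro[where K="norm x"])
      (simp_all add: cinner_add_left cinner_scaleC_left scaleR_scaleC
        order_trans[OF abs_Im_le_cmod cauchy_schwarz])
  ultimately have "(\<lambda>n. Im (cinner (op_poly (p n) T x) x)) \<longlonglongrightarrow> Im (cinner (S x) x)"
    using bounded_linear.tendsto by blast
  moreover have "Im (cinner (op_poly (p n) T x) x) = 0" for n
    using arg_cong[OF op_poly_adjoint[OF T sym, of "p n" x x], of Im]
      cinner_commute[of x "op_poly (p n) T x"] by (simp add: real)
  ultimately show "Im (cinner (cfc T f x) x) = 0"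
    by (simp add: cfc LIMSEQ_const_iff)
qed

section \<open>The logarithm and the determinant\<close>

text \<open>The spectrum lies in an interval on which the complex logarithm is the real one, which is
  continuous there.\<close>

lemma op_log_positive_invertible:
  fixes A :: "'a::chilbert_space \<Rightarrow> 'a"
  assumes A: "bounded_clinear A" and pos: "positive_op A" and inv: "invertible_op A"
  shows "bounded_clinear (op_log A)" and "Im (cinner (op_log A x) x) = 0"
proof -
  obtain a b where a: "0 < a" and spec: "op_spectrum A \<subseteq> complex_of_real ` {a..b}"
    using positive_invertible_op_spectrum[OF assms] by blast
  have cont: "continuous_on {a..b} (ln :: real \<Rightarrow> real)"
    using a by (intro continuous_intros) auto
  have ln: "ln (complex_of_real x) = complex_of_real (ln x)" if "x \<in> {a..b}" for x
    using a that by (intro Ln_of_real) auto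
  note sym = positive_op_imp_symmetric_op[OF A pos]
  show "bounded_clinear (op_log A)" and "Im (cinner (op_log A x) x) = 0"
    unfolding op_log_def using cfc_real_valued[OF A sym spec cont ln] by blast+
qed

lemma cinner_scaleR_quadratic:
  fixes T :: "'a::complex_inner \<Rightarrow> 'a"
  assumes "bounded_clinear T"
  shows "cinner (T (r *\<^sub>R x)) (r *\<^sub>R x) = complex_of_real (r\<^sup>2) * cinner (T x) x"
  by (simp add: scaleR_scaleC bounded_clinear_scaleC[OF assms] cinner_scaleC_left
      cinner_scaleC_right power2_eq_square)

theorem proposition2p6:
  fixes A B :: "'a::chilbert_space \<Rightarrow> 'a"
  assumes "bounded_clinear A" and "positive_op A" and "invertible_op A"
    and "bounded_clinear B" and "positive_op B" and "invertible_op B"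
  shows "A \<ggreater> B \<longleftrightarrow> (\<forall>x. norm x = 1 \<longrightarrow> \<Delta> x A \<ge> \<Delta> x B)"
proof -
  note logA = op_log_positive_invertible[OF assms(1-3)]
  note logB = op_log_positive_invertible[OF assms(4-6)]
  let ?a = "\<lambda>x. Re (cinner (op_log A x) x)" and ?b = "\<lambda>x. Re (cinner (op_log B x) x)"
  have det: "\<Delta> x A \<ge> \<Delta> x B \<longleftrightarrow> ?b x \<le> ?a x" for x
  proof -
    have "cinner (op_log A x) x = complex_of_real (?a x)" "cinner (op_log B x) x = complex_of_real (?b x)"
      using logA(2) logB(2) by (simp_all add: complex_eq_iff)
    then have "\<Delta> x A = complex_of_real (exp (?a x))" "\<Delta> x B = complex_of_real (exp (?b x))"
      unfolding fs_det_def by (metis exp_of_real)+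
    then show ?thesis by (simp add: less_eq_complex_def)
  qed
  have chaotic: "A \<ggreater> B \<longleftrightarrow> (\<forall>x. ?b x \<le> ?a x)"
    using logA(2) logB(2)
    by (simp add: chaotic_ge_def op_ge_def less_eq_complex_def cinner_diff_left)
  have "?b x \<le> ?a x" if unit: "\<And>u. norm u = 1 \<Longrightarrow> ?b u \<le> ?a u" for x
  proof (cases "x = 0")
    case False
    define u where "u = (1 / norm x) *\<^sub>R x"
    have "norm u = 1" and x: "x = norm x *\<^sub>R u" using False by (simp_all add: u_def)
    have "(norm x)\<^sup>2 * ?b u \<le> (norm x)\<^sup>2 * ?a u"
      by (intro mult_left_mono unit \<open>norm u = 1\<close>) simp
    moreover have "?a x = (norm x)\<^sup>2 * ?a u" "?b x = (norm x)\<^sup>2 * ?b u"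
      using cinner_scaleR_quadratic[OF logA(1), of "norm x" u]
        cinner_scaleR_quadratic[OF logB(1), of "norm x" u]
      by (simp_all flip: x del: of_real_power)
    ultimately show ?thesis by simp
  qed simp
  then show ?thesis unfolding chaotic det by blast
qed

end
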